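(* Let $N\ge 1$, let $z_0,\dots,z_N\in\mathbb C$ be pairwise distinct, $f_0,\dots,f_N\in\mathbb C$ and $z,t\in\mathbb C$ with $z\ne tz_j$ for $j=0,1,\dots,N$. Assume that all $z_j$, $f_j$, $z$, $t$ are exactly representable in the floating point arithmetic used, and that the products $tz_j$ are computed exactly, i.e. $\mathrm{cfl}(tz_j)=tz_j$ for $j=0,1,\dots,N$. Then the values $\tilde p_n(z;t)$, $n=0,1,\dots,N$, computed in floating point arithmetic by Algorithm II (described in the context) satisfy $$\tilde p_{n}(z;t)=\sum_{j=0}^{n}\bigl[f_j(1+\delta_j^{(n)})\bigr]\prod_{i=0,\; i\neq j}^n \frac{z-tz_{i}}{z_{j}-z_{i}}$$ for some numbers $\delta_j^{(n)}$ with $$|\delta_j^{(n)}| \leq \epsilon_M k_N+\mathcal O(\epsilon_M^{2}),\qquad k_N = (N+1)\cdot\begin{cases} 5 & \text{in the real case,}\\ 8+2\sqrt 2 & \text{in the complex case.}\end{cases}$$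
   Context: Algorithm II. Given pairwise distinct $z_0,\dots,z_N$, values $f_0,\dots,f_N$, and $z,t$ (real or complex) with $z\neq tz_j$ for all $j$: Set $b_j^{(0)}:=\dfrac{f_j}{z-tz_j}$ for $j=0,\dots,N$; $A_0:=z-tz_0$; $B_0:=b_0^{(0)}$; $p_0(z;t):=A_0B_0$. For $n=1,2,\dots,N$: $A_n:=(z-tz_n)A_{n-1}$; $b_j^{(n)}:=\dfrac{b_j^{(n-1)}}{z_j-z_n}$ for $j=0,1,\dots,n-1$; $b_n^{(n)}:=\dfrac{b_n^{(0)}}{\prod_{j=0}^{n-1}(z_n-z_j)}$; $B_n:=\sum_{j=0}^n b_j^{(n)}$; $p_n(z;t):=A_nB_n$. The operations are carried out as written; the product in the denominator of $b_n^{(n)}$ is formed with $n$ subtractions and $n-1$ successive multiplications followed by one division, and the sum $B_n$ is formed with $n$ successive additions. In exact arithmetic $p_n(z;t)=\sum_{j=0}^n f_j\prod_{i=0,\,i\ne j}^n\frac{z-tz_i}{z_j-z_i}$. Floating point model. Quantities with a tilde are those computed in floating point arithmetic. $\epsilon_M>0$ is the machine unit. Exactly representable data enter the computation without rounding error. In the real case (all of $z_j,f_j,z,t$ real, real arithmetic fl) every operation satisfies $\mathrm{fl}(x\odot y)=(x\odot y)(1+\delta)$ with $|\delta|\le\epsilon_M$, for $\odot\in\{+,-,*,/\}$. In the complex case (complex arithmetic cfl implemented using real arithmetic) every operation satisfies $\mathrm{cfl}(x\odot y)=(x\odot y)(1+\delta)$ with complex $\delta$, $|\delta|\le c_\odot\epsilon_M$,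 where $c_\odot=1$ for $\odot\in\{+,-\}$, $c_\odot=1+\sqrt2$ for $\odot=*$, and $c_\odot=4+\sqrt2$ for $\odot=/$. In the real case, cfl in the claim means fl. Convention for $\mathcal O(\epsilon_M^2)$: the bound is understood as $\epsilon_M\to0$ with $N$ and the data $z_j,f_j,z,t$ fixed, i.e. there exist $C,\epsilon_0>0$ depending only on $N$ and the data such that, for every floating point arithmetic with machine unit $\epsilon_M\le\epsilon_0$ in which exactly representable data enter without rounding error and every operation $\odot\in\{+,-,*,/\}$ returns $(x\odot y)(1+\delta)$ with $|\delta|\le\epsilon_M$ (real case), respectively $|\delta|\le c_\odot\epsilon_M$ with $c_+=c_-=1$, $c_*=1+\sqrt2$, $c_/=4+\sqrt2$ (complex case), the term is at most $C\epsilon_M^2$. *)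

theory Defs
  imports Complex_Main
begin

datatype fp_op = Add | Sub | Mul | Div

primrec exact_op :: "fp_op \<Rightarrow> 'a::field \<Rightarrow> 'a \<Rightarrow> 'a" where
  "exact_op Add x y = x + y"
| "exact_op Sub x y = x - y"
| "exact_op Mul x y = x * y"
| "exact_op Div x y = x / y"

text \<open>
  A floating point arithmetic is a set \<open>F\<close> of exactly representable numbers together with
  computed operations \<open>fl\<close> on \<open>F\<close>. The machine unit is \<open>eps\<close>, and \<open>c\<close> gives, for each operation,
  the constant in its relative error bound. Values of \<open>fl\<close> outside \<open>F\<close>, and of division by zero,
  are unconstrained; overflow and underflow are not modelled, so \<open>F\<close> is closed under \<open>fl\<close>.
\<close>

definition fp_arithmetic ::
  "(fp_op \<Rightarrow> real) \<Rightarrow> real \<Rightarrow> 'a::real_normed_field set \<Rightarrow> (fp_op \<Rightarrow> 'a \<Rightarrow> 'a \<Rightarrow> 'a) \<Rightarrow> bool" where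
  "fp_arithmetic c eps F fl \<longleftrightarrow> eps > 0 \<and>
     (\<forall>opn. \<forall>x\<in>F. \<forall>y\<in>F. (opn = Div \<longrightarrow> y \<noteq> 0) \<longrightarrow>
        fl opn x y \<in> F \<and>
        (\<exists>\<delta>. norm \<delta> \<le> c opn * eps \<and> fl opn x y = exact_op opn x y * (1 + \<delta>)))"

definition real_op_const :: "fp_op \<Rightarrow> real" where
  "real_op_const opn = 1"

primrec complex_op_const :: "fp_op \<Rightarrow> real" where
  "complex_op_const Add = 1"
| "complex_op_const Sub = 1"
| "complex_op_const Mul = 1 + sqrt 2"
| "complex_op_const Div = 4 + sqrt 2"

text \<open>Left-to-right accumulation of \<open>x 0, \<dots>, x n\<close>, using \<open>n\<close> applications of \<open>g\<close>.\<close>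

primrec accumulate :: "('a \<Rightarrow> 'a \<Rightarrow> 'a) \<Rightarrow> (nat \<Rightarrow> 'a) \<Rightarrow> nat \<Rightarrow> 'a" where
  "accumulate g x 0 = x 0"
| "accumulate g x (Suc n) = g (accumulate g x n) (x (Suc n))"

text \<open>
  The algorithm, with every operation carried out by \<open>fl\<close>: for \<open>fl = exact_op\<close> it is performed in
  exact arithmetic, for a floating point \<open>fl\<close> the functions below are the computed quantities.
\<close>

definition alg_factor ::
  "(fp_op \<Rightarrow> 'a \<Rightarrow> 'a \<Rightarrow> 'a) \<Rightarrow> (nat \<Rightarrow> 'a) \<Rightarrow> 'a \<Rightarrow> 'a \<Rightarrow> nat \<Rightarrow> 'a" where
  "alg_factor fl zs z t j = fl Sub z (fl Mul t (zs j))"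

primrec alg_A ::
  "(fp_op \<Rightarrow> 'a \<Rightarrow> 'a \<Rightarrow> 'a) \<Rightarrow> (nat \<Rightarrow> 'a) \<Rightarrow> 'a \<Rightarrow> 'a \<Rightarrow> nat \<Rightarrow> 'a" where
  "alg_A fl zs z t 0 = alg_factor fl zs z t 0"
| "alg_A fl zs z t (Suc n) = fl Mul (alg_factor fl zs z t (Suc n)) (alg_A fl zs z t n)"

definition alg_b0 ::
  "(fp_op \<Rightarrow> 'a \<Rightarrow> 'a \<Rightarrow> 'a) \<Rightarrow> (nat \<Rightarrow> 'a) \<Rightarrow> (nat \<Rightarrow> 'a) \<Rightarrow> 'a \<Rightarrow> 'a \<Rightarrow> nat \<Rightarrow> 'a" where
  "alg_b0 fl zs f z t j = fl Div (f j) (alg_factor fl zs z t j)"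

text \<open>
  \<open>alg_b fl zs f z t n j\<close> is $b_j^{(n)}$. For \<open>n > 0\<close> the algorithm defines it for \<open>j \<le> n\<close> only;
  the values for \<open>j > n > 0\<close> are never used, so the second branch below is relevant only for
  \<open>j = Suc n\<close>.
\<close>

primrec alg_b ::
  "(fp_op \<Rightarrow> 'a \<Rightarrow> 'a \<Rightarrow> 'a) \<Rightarrow> (nat \<Rightarrow> 'a) \<Rightarrow> (nat \<Rightarrow> 'a) \<Rightarrow> 'a \<Rightarrow> 'a \<Rightarrow> nat \<Rightarrow> nat \<Rightarrow> 'a" where
  "alg_b fl zs f z t 0 j = alg_b0 fl zs f z t j"
| "alg_b fl zs f z t (Suc n) j =
     (if j \<le> n then fl Div (alg_b fl zs f z t n j) (fl Sub (zs j) (zs (Suc n)))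
      else fl Div (alg_b0 fl zs f z t j) (accumulate (fl Mul) (\<lambda>i. fl Sub (zs j) (zs i)) n))"

definition alg_B ::
  "(fp_op \<Rightarrow> 'a \<Rightarrow> 'a \<Rightarrow> 'a) \<Rightarrow> (nat \<Rightarrow> 'a) \<Rightarrow> (nat \<Rightarrow> 'a) \<Rightarrow> 'a \<Rightarrow> 'a \<Rightarrow> nat \<Rightarrow> 'a" where
  "alg_B fl zs f z t n = accumulate (fl Add) (alg_b fl zs f z t n) n"

definition alg_p ::
  "(fp_op \<Rightarrow> 'a \<Rightarrow> 'a \<Rightarrow> 'a) \<Rightarrow> (nat \<Rightarrow> 'a) \<Rightarrow> (nat \<Rightarrow> 'a) \<Rightarrow> 'a \<Rightarrow> 'a \<Rightarrow> nat \<Rightarrow> 'a" where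
  "alg_p fl zs f z t n = fl Mul (alg_A fl zs z t n) (alg_B fl zs f z t n)"

end

theory Submission
  imports Defs
begin

text \<open>
  Every quantity of the algorithm other than the sums \<open>B\<^sub>n\<close> is obtained by multiplications and
  divisions from the data \<open>f\<^sub>j\<close> and from differences of exactly known numbers, so cancellation
  cannot amplify earlier errors there: each rounding contributes a factor close to one, and all of
  these factors can be collected in front of \<open>f\<^sub>j\<close>. The rounding of an
  addition multiplies every term of the new partial sum by a common factor, so the sum \<open>B\<^sub>n\<close> also only distributes factors over
  its terms. Hence the computed value is the exact one for data \<open>f\<^sub>j\<close> multiplied by a product of
  rounding factors, and the theorem amounts to counting them.

  Let \<open>w\<close> assign its share of the error to each operation. The term with index \<open>j\<close> receives

    \<^item> from \<open>A\<^sub>n\<close>: \<open>n + 1\<close> subtractions and \<open>n\<close> multiplications (\<open>alg_A_approx\<close>);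
    \<^item> from \<open>b\<^sub>j\<close>: \<open>n + 1\<close> subtractions and \<open>n + 1\<close> other operations, which are divisions or
      multiplications in the denominator with which \<open>b\<^sub>j\<close> starts; as a multiplication is no less
      accurate than a division, each counts as a division (\<open>alg_b_approx\<close>);
    \<^item> from \<open>B\<^sub>n\<close>: at most \<open>n\<close> additions (\<open>accumulate_Add_approx\<close>);
    \<^item> one final multiplication.

  The total is at most \<open>n + 1\<close> times \<open>w Add + 2 * w Sub + w Mul + w Div\<close>, which gives the constants
  \<open>5\<close> and \<open>3 + (1 + sqrt 2) + (4 + sqrt 2) = 8 + 2 * sqrt 2\<close>.

  To count without tracking higher order terms, deviations from one are measured on an exponential
  scale: a factor has weight \<open>w\<close> if it and its inverse differ from one by at most \<open>exp w - 1\<close>.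
  Weights add under multiplication and division alike. A single rounding error of size \<open>c * eps\<close>
  has weight \<open>c * eps + O(eps\<^sup>2)\<close>, and weights are converted back to ordinary bounds only at the end.
\<close>

section \<open>Factors close to one\<close>

definition near_one :: "real \<Rightarrow> 'a::real_normed_field \<Rightarrow> bool" where
  "near_one w u \<longleftrightarrow>
     u \<noteq> 0 \<and> norm (u - 1) \<le> exp w - 1 \<and> norm (inverse u - 1) \<le> exp w - 1"

lemma near_one_one: "0 \<le> w \<Longrightarrow> near_one w 1"
  by (simp add: near_one_def)

lemma near_one_mono: "near_one v u \<Longrightarrow> v \<le> w \<Longrightarrow> near_one w u"
  unfolding near_one_def by (smt (verit) exp_le_cancel_iff)

lemma near_one_inverse: "near_one w u \<Longrightarrow> near_one w (inverse u)"
  by (auto simp: near_one_def)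

lemma norm_mult_minus_one_le_exp:
  fixes u v :: "'a::real_normed_field"
  assumes "norm (u - 1) \<le> exp a - 1" "norm (v - 1) \<le> exp b - 1"
  shows "norm (u * v - 1) \<le> exp (a + b) - 1"
proof -
  have eq: "u * v - 1 = (u - 1) * (v - 1) + (u - 1) + (v - 1)"
    by (simp add: algebra_simps)
  have "norm (u * v - 1) \<le> norm (u - 1) * norm (v - 1) + norm (u - 1) + norm (v - 1)"
    unfolding eq norm_mult[symmetric]
    by (intro norm_triangle_le add_mono norm_triangle_ineq order_refl)
  also have "\<dots> \<le> (exp a - 1) * (exp b - 1) + (exp a - 1) + (exp b - 1)"
    using assms order_trans[OF norm_ge_zero assms(1)]
    by (intro add_mono mult_mono) auto
  also have "\<dots> = exp (a + b) - 1"
    by (simp add: exp_add algebra_simps)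
  finally show ?thesis .
qed

lemma near_one_mult:
  assumes "near_one a u" "near_one b v"
  shows "near_one (a + b) (u * v)"
  using assms norm_mult_minus_one_le_exp[of u a v b]
    norm_mult_minus_one_le_exp[of "inverse u" a "inverse v" b]
  by (auto simp: near_one_def)

text \<open>
  The inverse is the worse of the two sides: it deviates from one by up to \<open>1 / (1 - y) - 1\<close>, and
  the quadratic term in the weight accounts for \<open>ln (1 - y) \<ge> - y - 2 * y\<^sup>2\<close>.
\<close>

lemma near_one_rounding:
  fixes \<delta> :: "'a::real_normed_field"
  assumes "norm \<delta> \<le> y" "y \<le> 1 / 2"
  shows "near_one (y + 2 * y\<^sup>2) (1 + \<delta>)"
proof -
  have y0: "0 \<le> y"
    using assms(1) norm_ge_zero order_trans by blast
  have "- (y + 2 * y\<^sup>2) \<le> ln (1 - y)"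
    using ln_one_minus_pos_lower_bound[of y] y0 assms(2) by simp
  then have "exp (- (y + 2 * y\<^sup>2)) \<le> 1 - y"
    using assms(2) by (simp add: ln_ge_iff)
  then have inv: "inverse (1 - y) \<le> exp (y + 2 * y\<^sup>2)"
    using assms(2) by (metis exp_gt_zero exp_minus inverse_inverse_eq le_imp_inverse_le)
  have nz: "1 + \<delta> \<noteq> 0"
  proof
    assume "1 + \<delta> = 0"
    then have "norm \<delta> = 1"
      by (metis add_eq_0_iff norm_minus_cancel norm_one)
    with assms show False by simp
  qed
  have "1 - y \<le> norm (1 + \<delta>)"
    using norm_triangle_ineq2[of 1 "- \<delta>"] assms(1) by simp
  then have "norm \<delta> / norm (1 + \<delta>) \<le> y / (1 - y)"
    using assms y0 by (intro frac_le) auto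
  also have "\<dots> = inverse (1 - y) - 1"
    using assms(2) by (simp add: field_simps)
  finally have "norm \<delta> / norm (1 + \<delta>) \<le> exp (y + 2 * y\<^sup>2) - 1"
    using inv by linarith
  moreover have "inverse (1 + \<delta>) - 1 = - \<delta> / (1 + \<delta>)"
    using nz by (simp add: field_simps)
  then have "norm (inverse (1 + \<delta>) - 1) = norm \<delta> / norm (1 + \<delta>)"
    by (simp add: norm_divide)
  moreover have "y \<le> exp (y + 2 * y\<^sup>2) - 1"
    using exp_ge_add_one_self[of "y + 2 * y\<^sup>2"] by (smt (verit) zero_le_power2)
  ultimately show ?thesis
    using nz assms(1) by (simp add: near_one_def)
qed

section \<open>Relative approximation\<close>

definition rel_approx :: "real \<Rightarrow> 'a::real_normed_field \<Rightarrow> 'a \<Rightarrow> bool" where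
  "rel_approx w x y \<longleftrightarrow> (\<exists>u. near_one w u \<and> x = y * u)"

lemma rel_approx_refl: "rel_approx 0 x x"
  unfolding rel_approx_def by (intro exI[of _ 1]) (simp add: near_one_one)

lemma rel_approx_mono: "rel_approx v x y \<Longrightarrow> v \<le> w \<Longrightarrow> rel_approx w x y"
  unfolding rel_approx_def using near_one_mono by blast

lemma rel_approx_nonzero: "rel_approx w x y \<Longrightarrow> y \<noteq> 0 \<Longrightarrow> x \<noteq> 0"
  by (auto simp: rel_approx_def near_one_def)

lemma rel_approx_trans:
  assumes "rel_approx v x y" "rel_approx w y z"
  shows "rel_approx (w + v) x z"
proof -
  obtain a b where "near_one v a" "x = y * a" "near_one w b" "y = z * b"
    using assms by (auto simp: rel_approx_def)
  then show ?thesis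
    using near_one_mult[of w b v a] by (auto simp: rel_approx_def mult.assoc)
qed

lemma rel_approx_mult:
  assumes "rel_approx a x x'" "rel_approx b y y'"
  shows "rel_approx (a + b) (x * y) (x' * y')"
proof -
  obtain u v where "near_one a u" "x = x' * u" "near_one b v" "y = y' * v"
    using assms by (auto simp: rel_approx_def)
  then show ?thesis
    using near_one_mult[of a u b v] by (auto simp: rel_approx_def mult_ac)
qed

lemma rel_approx_divide:
  assumes "rel_approx a x x'" "rel_approx b y y'"
  shows "rel_approx (a + b) (x / y) (x' / y')"
proof -
  obtain v where "near_one b v" "y = y' * v"
    using assms by (auto simp: rel_approx_def)
  then have "rel_approx b (inverse y) (inverse y')"
    using near_one_inverse[of b v] by (auto simp: rel_approx_def)
  from rel_approx_mult[OF assms(1) this] show ?thesis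
    by (simp add: divide_inverse)
qed

section \<open>Arithmetic with weighted rounding factors\<close>

locale rounded_arithmetic =
  fixes F :: "'a::real_normed_field set"
    and fl :: "fp_op \<Rightarrow> 'a \<Rightarrow> 'a \<Rightarrow> 'a"
    and w :: "fp_op \<Rightarrow> real"
  assumes weight_nonneg: "0 \<le> w opn"
    and fl_closed: "x \<in> F \<Longrightarrow> y \<in> F \<Longrightarrow> (opn = Div \<Longrightarrow> y \<noteq> 0) \<Longrightarrow> fl opn x y \<in> F"
    and fl_approx: "x \<in> F \<Longrightarrow> y \<in> F \<Longrightarrow> (opn = Div \<Longrightarrow> y \<noteq> 0) \<Longrightarrow>
           rel_approx (w opn) (fl opn x y) (exact_op opn x y)"
begin

lemma fl_Sub:
  assumes "x \<in> F" "y \<in> F"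
  shows "fl Sub x y \<in> F" "rel_approx (w Sub) (fl Sub x y) (x - y)"
  using fl_closed[of x y Sub] fl_approx[of x y Sub] assms by auto

lemma fl_Mul:
  assumes "x \<in> F" "y \<in> F" "rel_approx a x x'" "rel_approx b y y'"
  shows "fl Mul x y \<in> F" "rel_approx (a + b + w Mul) (fl Mul x y) (x' * y')"
  using fl_closed[of x y Mul] rel_approx_trans[OF _ rel_approx_mult[OF assms(3,4)]]
    fl_approx[of x y Mul] assms by auto

lemma fl_Div:
  assumes "x \<in> F" "y \<in> F" "rel_approx a x x'" "rel_approx b y y'" "y' \<noteq> 0"
  shows "fl Div x y \<in> F" "rel_approx (a + b + w Div) (fl Div x y) (x' / y')"
  using fl_closed[of x y Div] rel_approx_trans[OF _ rel_approx_divide[OF assms(3,4)]]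
    fl_approx[of x y Div] rel_approx_nonzero[OF assms(4,5)] assms by auto

lemma accumulate_Mul_approx:
  assumes "\<And>i. i \<le> n \<Longrightarrow> x i \<in> F \<and> rel_approx a (x i) (y i)"
  shows "accumulate (fl Mul) x n \<in> F \<and>
    rel_approx (real (n + 1) * a + real n * w Mul) (accumulate (fl Mul) x n) (\<Prod>i\<le>n. y i)"
  using assms
proof (induction n)
  case 0
  then show ?case by simp
next
  case (Suc n)
  have "accumulate (fl Mul) x n \<in> F"
    "rel_approx (real (n + 1) * a + real n * w Mul) (accumulate (fl Mul) x n) (\<Prod>i\<le>n. y i)"
    using Suc by auto
  from fl_Mul[OF this(1) _ this(2), of "x (Suc n)" a "y (Suc n)"] Suc.prems[of "Suc n"]
  show ?case by (simp add: algebra_simps)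
qed

text \<open>
  The sum is not a relative approximation of the exact sum, since its terms may cancel. The
  rounding factors have to stay with the terms.
\<close>

lemma accumulate_Add_approx:
  assumes "\<And>i. i \<le> n \<Longrightarrow> x i \<in> F"
  shows "accumulate (fl Add) x n \<in> F \<and>
    (\<exists>v. (\<forall>i\<le>n. near_one (real n * w Add) (v i)) \<and> accumulate (fl Add) x n = (\<Sum>i\<le>n. x i * v i))"
  using assms
proof (induction n)
  case 0
  then show ?case
    using near_one_one[of 0] by (auto intro!: exI[of _ "\<lambda>_. 1"])
next
  case (Suc n)
  obtain v where v: "\<And>i. i \<le> n \<Longrightarrow> near_one (real n * w Add) (v i)"
    "accumulate (fl Add) x n = (\<Sum>i\<le>n. x i * v i)" and F: "accumulate (fl Add) x n \<in> F"
    using Suc.IH Suc.prems by (meson le_Suc_eq)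
  have xF: "x (Suc n) \<in> F"
    using Suc.prems by simp
  obtain u where u: "near_one (w Add) u"
    "fl Add (accumulate (fl Add) x n) (x (Suc n)) = (accumulate (fl Add) x n + x (Suc n)) * u"
    using fl_approx[OF F xF, of Add] by (auto simp: rel_approx_def)
  \<comment> \<open>The term added last has met a single rounding only; its weight is rounded up.\<close>
  define v' where "v' i = (if i \<le> n then v i * u else u)" for i
  have "near_one (real (Suc n) * w Add) (v' i)" for i
  proof (cases "i \<le> n")
    case True
    then show ?thesis
      using near_one_mult[OF v(1) u(1)] by (simp add: v'_def algebra_simps)
  next
    case False
    then show ?thesis
      using near_one_mono[OF u(1), of "real (Suc n) * w Add"] weight_nonneg[of Add]
      by (simp add: v'_def algebra_simps)
  qed
  moreover have "fl Add (accumulate (fl Add) x n) (x (Suc n)) = (\<Sum>i\<le>Suc n. x i * v' i)"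
    by (subst u(2)) (simp add: v(2) v'_def distrib_right sum_distrib_right mult.assoc)
  ultimately show ?case
    unfolding accumulate.simps using fl_closed[OF F xF, of Add] by blast
qed

end

section \<open>The quantities of the algorithm\<close>

locale interpolation_data = rounded_arithmetic F fl w
  for F :: "'a::real_normed_field set" and fl w +
  fixes N :: nat and zs f :: "nat \<Rightarrow> 'a" and z t :: 'a
  assumes nodes_distinct: "inj_on zs {..N}"
    and factor_nonzero: "j \<le> N \<Longrightarrow> z \<noteq> t * zs j"
    and data_F: "j \<le> N \<Longrightarrow> zs j \<in> F" "j \<le> N \<Longrightarrow> f j \<in> F" "z \<in> F" "t \<in> F"
    and products_exact: "j \<le> N \<Longrightarrow> fl Mul t (zs j) = t * zs j"
    and Mul_le_Div: "w Mul \<le> w Div"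
begin

lemma alg_factor_approx:
  assumes "j \<le> N"
  shows "alg_factor fl zs z t j \<in> F" "rel_approx (w Sub) (alg_factor fl zs z t j) (z - t * zs j)"
proof -
  have "t * zs j \<in> F"
    using fl_closed[of t "zs j" Mul] data_F products_exact assms by auto
  then show "alg_factor fl zs z t j \<in> F"
    "rel_approx (w Sub) (alg_factor fl zs z t j) (z - t * zs j)"
    using fl_Sub data_F assms by (auto simp: alg_factor_def products_exact)
qed

lemma alg_A_approx:
  assumes "n \<le> N"
  shows "alg_A fl zs z t n \<in> F \<and>
    rel_approx (real (n + 1) * w Sub + real n * w Mul) (alg_A fl zs z t n) (\<Prod>i\<le>n. z - t * zs i)"
  using assms
proof (induction n)
  case 0
  then show ?case using alg_factor_approx[of 0] by simp
next
  case (Suc n)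
  have fac: "alg_factor fl zs z t (Suc n) \<in> F"
    "rel_approx (w Sub) (alg_factor fl zs z t (Suc n)) (z - t * zs (Suc n))"
    using alg_factor_approx[of "Suc n"] Suc.prems by auto
  have IH: "alg_A fl zs z t n \<in> F"
    "rel_approx (real (n + 1) * w Sub + real n * w Mul) (alg_A fl zs z t n) (\<Prod>i\<le>n. z - t * zs i)"
    using Suc by auto
  show ?case
    using fl_Mul[OF fac(1) IH(1) fac(2) IH(2)] by (simp add: algebra_simps)
qed

lemma alg_b0_approx:
  assumes "j \<le> N"
  shows "alg_b0 fl zs f z t j \<in> F"
    "rel_approx (w Sub + w Div) (alg_b0 fl zs f z t j) (f j / (z - t * zs j))"
  using fl_Div[OF data_F(2) alg_factor_approx(1) rel_approx_refl alg_factor_approx(2)]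
    factor_nonzero assms by (auto simp: alg_b0_def)

text \<open>
  The coefficient with index \<open>j \<ge> 1\<close> starts with one division by a product formed with \<open>j - 1\<close>
  multiplications, where the coefficient with index \<open>0\<close> has by then undergone \<open>j\<close> divisions.
  Hence the roundings of the indices \<open>0\<close> and \<open>1\<close> have exactly the stated total weight, and
  \<open>w Mul \<le> w Div\<close> makes it a bound for all larger indices.
\<close>

lemma alg_b_approx:
  assumes "n \<le> N" "j \<le> n"
  shows "alg_b fl zs f z t n j \<in> F \<and>
    rel_approx (real (n + 1) * (w Sub + w Div)) (alg_b fl zs f z t n j)
      (f j / (z - t * zs j) / (\<Prod>i\<in>{..n} - {j}. zs j - zs i))"
  using assms
proof (induction n)
  case 0
  then show ?case using alg_b0_approx[of 0] by simp
next
  case (Suc n)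
  have diff: "fl Sub (zs j) (zs i) \<in> F \<and> rel_approx (w Sub) (fl Sub (zs j) (zs i)) (zs j - zs i)"
    if "i \<le> N" for i
    using fl_Sub data_F Suc.prems that by auto
  have diff_nz: "zs j - zs i \<noteq> 0" if "i \<le> N" "i \<noteq> j" for i
    using nodes_distinct Suc.prems that by (auto dest: inj_onD)
  show ?case
  proof (cases "j \<le> n")
    case True
    have IH: "alg_b fl zs f z t n j \<in> F"
      "rel_approx (real (n + 1) * (w Sub + w Div)) (alg_b fl zs f z t n j)
        (f j / (z - t * zs j) / (\<Prod>i\<in>{..n} - {j}. zs j - zs i))"
      using Suc True by auto
    have "{..Suc n} - {j} = insert (Suc n) ({..n} - {j})"
      using True by auto
    then have "(\<Prod>i\<in>{..Suc n} - {j}. zs j - zs i) =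
        (\<Prod>i\<in>{..n} - {j}. zs j - zs i) * (zs j - zs (Suc n))"
      by (simp add: mult.commute)
    then have quot: "f j / (z - t * zs j) / (\<Prod>i\<in>{..Suc n} - {j}. zs j - zs i) =
        f j / (z - t * zs j) / (\<Prod>i\<in>{..n} - {j}. zs j - zs i) / (zs j - zs (Suc n))"
      by simp
    have weight: "real (Suc n + 1) * (w Sub + w Div) =
        real (n + 1) * (w Sub + w Div) + w Sub + w Div"
      by (simp add: algebra_simps)
    have "zs j - zs (Suc n) \<noteq> 0"
      using diff_nz[of "Suc n"] Suc.prems True by auto
    from fl_Div[OF IH(1) _ IH(2) _ this, of "fl Sub (zs j) (zs (Suc n))" "w Sub"] diff[of "Suc n"]
    show ?thesis
      using True Suc.prems unfolding quot weight by auto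
  next
    case False
    then have j: "j = Suc n"
      using Suc.prems by simp
    let ?D = "accumulate (fl Mul) (\<lambda>i. fl Sub (zs j) (zs i)) n"
    have "{..Suc n} - {j} = {..n}"
      using j by auto
    then have prod: "(\<Prod>i\<in>{..Suc n} - {j}. zs j - zs i) = (\<Prod>i\<le>n. zs j - zs i)"
      by simp
    have D: "?D \<in> F" "rel_approx (real (n + 1) * w Sub + real n * w Mul) ?D (\<Prod>i\<le>n. zs j - zs i)"
      using accumulate_Mul_approx[of n "\<lambda>i. fl Sub (zs j) (zs i)" "w Sub" "\<lambda>i. zs j - zs i"]
        diff Suc.prems by auto
    have nz: "(\<Prod>i\<le>n. zs j - zs i) \<noteq> 0"
      using diff_nz Suc.prems j by (simp add: prod_zero_iff del: right_minus_eq)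
    have b0: "alg_b0 fl zs f z t j \<in> F"
      "rel_approx (w Sub + w Div) (alg_b0 fl zs f z t j) (f j / (z - t * zs j))"
      using alg_b0_approx[of j] Suc.prems by auto
    have "w Sub + w Div + (real (n + 1) * w Sub + real n * w Mul) + w Div
        \<le> real (Suc n + 1) * (w Sub + w Div)"
      using mult_left_mono[OF Mul_le_Div, of "real n"] by (simp add: algebra_simps)
    then show ?thesis
      using fl_Div[OF b0(1) D(1) b0(2) D(2) nz] False
      by (auto simp: prod intro: rel_approx_mono)
  qed
qed

lemma alg_p_backward_error:
  assumes "n \<le> N"
  shows "\<exists>u. (\<forall>j\<le>n. near_one (real (n + 1) * (w Add + 2 * w Sub + w Mul + w Div)) (u j)) \<and>
    alg_p fl zs f z t n = (\<Sum>j\<le>n. (f j * u j) * (\<Prod>i\<in>{..n} - {j}. (z - t * zs i) / (zs j - zs i)))"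
proof -
  let ?b = "alg_b fl zs f z t n"
  define b where "b j = f j / (z - t * zs j) / (\<Prod>i\<in>{..n} - {j}. zs j - zs i)" for j
  define P where "P = (\<Prod>i\<le>n. z - t * zs i)"
  have "\<forall>j\<in>{..n}. \<exists>u. near_one (real (n + 1) * (w Sub + w Div)) u \<and> ?b j = b j * u"
    using alg_b_approx[OF assms] by (auto simp: rel_approx_def b_def)
  then obtain \<beta> where \<beta>: "\<And>j. j \<le> n \<Longrightarrow> near_one (real (n + 1) * (w Sub + w Div)) (\<beta> j)"
    "\<And>j. j \<le> n \<Longrightarrow> ?b j = b j * \<beta> j"
    by (metis atMost_iff)
  obtain v where v: "\<And>j. j \<le> n \<Longrightarrow> near_one (real n * w Add) (v j)"
    "alg_B fl zs f z t n = (\<Sum>j\<le>n. ?b j * v j)" and BF: "alg_B fl zs f z t n \<in> F"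
    using accumulate_Add_approx[of n ?b] alg_b_approx[OF assms] unfolding alg_B_def by meson
  obtain a where a: "near_one (real (n + 1) * w Sub + real n * w Mul) a"
    "alg_A fl zs z t n = P * a" and AF: "alg_A fl zs z t n \<in> F"
    using alg_A_approx[OF assms] by (auto simp: rel_approx_def P_def)
  obtain m where m: "near_one (w Mul) m"
    "alg_p fl zs f z t n = alg_A fl zs z t n * alg_B fl zs f z t n * m"
    using fl_approx[OF AF BF, of Mul] by (auto simp: alg_p_def rel_approx_def)
  define u where "u j = a * (\<beta> j * v j) * m" for j
  have weight: "near_one (real (n + 1) * (w Add + 2 * w Sub + w Mul + w Div)) (u j)"
    if "j \<le> n" for j
    unfolding u_def
    by (rule near_one_mono[OF near_one_mult[OF near_one_mult[OF a(1)
            near_one_mult[OF \<beta>(1)[OF that] v(1)[OF that]]] m(1)]])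
      (use weight_nonneg[of Add] in \<open>simp add: algebra_simps\<close>)
  have exact: "P * b j = f j * (\<Prod>i\<in>{..n} - {j}. (z - t * zs i) / (zs j - zs i))"
    if "j \<le> n" for j
  proof -
    have "P = (z - t * zs j) * (\<Prod>i\<in>{..n} - {j}. z - t * zs i)"
      unfolding P_def using that by (intro prod.remove) auto
    moreover have "z - t * zs j \<noteq> 0"
      using factor_nonzero[of j] that assms by simp
    ultimately show ?thesis
      by (simp add: b_def prod_dividef)
  qed
  have "alg_p fl zs f z t n = (\<Sum>j\<le>n. (P * b j) * u j)"
    by (simp add: m(2) a(2) v(2) \<beta>(2) u_def sum_distrib_left sum_distrib_right mult_ac)
  also have "\<dots> = (\<Sum>j\<le>n. (f j * u j) * (\<Prod>i\<in>{..n} - {j}. (z - t * zs i) / (zs j - zs i)))"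
    by (intro sum.cong refl) (simp add: exact mult_ac)
  finally show ?thesis
    using weight by blast
qed

end

section \<open>From weights to first order bounds\<close>

text \<open>
  With \<open>M\<close> bounding all error constants and \<open>M * eps \<le> 1 / 2\<close>, an operation with constant \<open>c\<close> has
  weight at most \<open>c * h\<close> for the common step \<open>h = eps + 2 * M * eps\<^sup>2\<close>. Being linear in the
  constants, these weights can be summed as the constants themselves.
\<close>

lemma rounded_arithmetic_of_fp_arithmetic:
  assumes "fp_arithmetic c eps F fl"
    and c: "\<And>opn. 0 \<le> c opn" "\<And>opn. c opn \<le> M" and small: "M * eps \<le> 1 / 2"
  shows "rounded_arithmetic F fl (\<lambda>opn. c opn * (eps + 2 * M * eps\<^sup>2))"
proof
  have eps: "0 < eps"
    using assms(1) by (simp add: fp_arithmetic_def)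
  have M: "0 \<le> M"
    using c order_trans by blast
  fix opn
  show "0 \<le> c opn * (eps + 2 * M * eps\<^sup>2)"
    using c eps M by simp
  fix x y
  assume xy: "x \<in> F" "y \<in> F" "opn = Div \<Longrightarrow> y \<noteq> 0"
  then show "fl opn x y \<in> F"
    using assms(1) by (auto simp: fp_arithmetic_def)
  obtain \<delta> where \<delta>: "norm \<delta> \<le> c opn * eps" "fl opn x y = exact_op opn x y * (1 + \<delta>)"
    using assms(1) xy unfolding fp_arithmetic_def by blast
  have le: "c opn * eps \<le> M * eps"
    using c eps by (intro mult_right_mono) auto
  have "2 * (c opn * eps) * (c opn * eps) \<le> 2 * (c opn * eps) * (M * eps)"
    using le c eps by (intro mult_left_mono) auto
  then have "c opn * eps + 2 * (c opn * eps)\<^sup>2 \<le> c opn * (eps + 2 * M * eps\<^sup>2)"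
    by (simp add: power2_eq_square algebra_simps)
  with near_one_rounding[OF \<delta>(1)] le small
  have "near_one (c opn * (eps + 2 * M * eps\<^sup>2)) (1 + \<delta>)"
    by (meson near_one_mono order_trans)
  then show "rel_approx (c opn * (eps + 2 * M * eps\<^sup>2)) (fl opn x y) (exact_op opn x y)"
    using \<delta>(2) by (auto simp: rel_approx_def)
qed

lemma exp_minus_one_first_order:
  fixes K M eps :: real
  assumes "0 \<le> K" "0 \<le> eps" "M * eps \<le> 1 / 2" "2 * K * eps \<le> 1" "0 \<le> M"
  shows "exp (K * (eps + 2 * M * eps\<^sup>2)) - 1 \<le> eps * K + (2 * M * K + 4 * K\<^sup>2) * eps\<^sup>2"
proof -
  let ?x = "K * (eps + 2 * M * eps\<^sup>2)"
  have "(M * eps) * eps \<le> 1 / 2 * eps"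
    using assms by (intro mult_right_mono) auto
  then have "eps + 2 * M * eps\<^sup>2 \<le> 2 * eps"
    by (simp add: power2_eq_square)
  from mult_left_mono[OF this assms(1)] have x: "?x \<le> 2 * K * eps"
    by (simp add: mult_ac)
  have x0: "0 \<le> ?x"
    using assms by simp
  have "exp ?x \<le> 1 + ?x + ?x\<^sup>2"
    using exp_bound[OF x0] x assms(4) by linarith
  moreover have "?x\<^sup>2 \<le> (2 * K * eps)\<^sup>2"
    by (rule power_mono[OF x x0])
  ultimately show ?thesis
    by (simp add: power2_eq_square algebra_simps)
qed

lemma alg_p_backward_error_first_order:
  fixes zs f :: "nat \<Rightarrow> 'a::real_normed_field" and z t :: 'a
  assumes c: "\<And>opn. 0 \<le> c opn" "c Mul \<le> c Div"
    and data: "inj_on zs {..N}" "\<forall>j\<le>N. z \<noteq> t * zs j"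
    and K_eq: "K = real (N + 1) * (c Add + 2 * c Sub + c Mul + c Div)"
  shows "\<exists>C>0. \<exists>eps0>0. \<forall>eps F fl.
           fp_arithmetic c eps F fl \<longrightarrow> eps \<le> eps0 \<longrightarrow>
           (\<forall>j\<le>N. zs j \<in> F \<and> f j \<in> F) \<longrightarrow> z \<in> F \<longrightarrow> t \<in> F \<longrightarrow>
           (\<forall>j\<le>N. fl Mul t (zs j) = t * zs j) \<longrightarrow>
           (\<forall>n\<le>N. \<exists>\<delta> :: nat \<Rightarrow> 'a.
              alg_p fl zs f z t n =
                (\<Sum>j\<le>n. (f j * (1 + \<delta> j)) *
                   (\<Prod>i\<in>{..n} - {j}. (z - t * zs i) / (zs j - zs i))) \<and>
              (\<forall>j\<le>n. norm (\<delta> j) \<le> eps * K + C * eps\<^sup>2))"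
proof -
  define S where "S = c Add + 2 * c Sub + c Mul + c Div"
  define M where "M = 1 + S"
  have S: "0 \<le> S" and M: "0 < M"
    using c(1)[of Add] c(1)[of Sub] c(1)[of Mul] c(1)[of Div] by (auto simp: S_def M_def)
  have K: "K = real (N + 1) * S" "0 \<le> K"
    using S by (auto simp: K_eq S_def)
  have cM: "c opn \<le> M" for opn
    using c(1)[of Add] c(1)[of Sub] c(1)[of Mul] c(1)[of Div]
    by (cases opn) (auto simp: S_def M_def)
  define C where "C = 2 * M * K + 4 * K\<^sup>2 + 1"
  \<comment> \<open>Small enough for both \<open>M * eps \<le> 1 / 2\<close> and \<open>2 * K * eps \<le> 1\<close>.\<close>
  define eps0 where "eps0 = 1 / (2 * (M + K))"
  have C0: "C > 0"
    using M K by (auto simp: C_def intro!: add_nonneg_pos)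
  have eps0: "eps0 > 0"
    using M K by (simp add: eps0_def)
  have main: "\<exists>\<delta> :: nat \<Rightarrow> 'a.
      alg_p fl zs f z t n =
        (\<Sum>j\<le>n. (f j * (1 + \<delta> j)) * (\<Prod>i\<in>{..n} - {j}. (z - t * zs i) / (zs j - zs i))) \<and>
      (\<forall>j\<le>n. norm (\<delta> j) \<le> eps * K + C * eps\<^sup>2)"
    if fp: "fp_arithmetic c eps F fl" and le: "eps \<le> eps0"
      and F: "\<forall>j\<le>N. zs j \<in> F \<and> f j \<in> F" "z \<in> F" "t \<in> F"
      and exact: "\<forall>j\<le>N. fl Mul t (zs j) = t * zs j" and n: "n \<le> N"
    for eps F fl n
  proof -
    let ?h = "eps + 2 * M * eps\<^sup>2"
    have eps: "0 < eps"
      using fp by (simp add: fp_arithmetic_def)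
    have "(M + K) * eps \<le> 1 / 2"
      using le M K(2) by (simp add: eps0_def field_simps)
    then have "M * eps + K * eps \<le> 1 / 2"
      by (simp add: distrib_right)
    moreover have "0 \<le> M * eps" "0 \<le> K * eps"
      using M K(2) eps by auto
    ultimately have small: "M * eps \<le> 1 / 2" "2 * K * eps \<le> 1"
      by linarith+
    interpret rounded_arithmetic F fl "\<lambda>opn. c opn * ?h"
      by (rule rounded_arithmetic_of_fp_arithmetic[OF fp c(1) cM small(1)])
    interpret interpolation_data F fl "\<lambda>opn. c opn * ?h" N zs f z t
      by unfold_locales (use data F exact c(2) eps M in \<open>auto intro: mult_right_mono\<close>)
    obtain u where u: "\<And>j. j \<le> n \<Longrightarrow> near_one (real (n + 1) *
          (c Add * ?h + 2 * (c Sub * ?h) + c Mul * ?h + c Div * ?h)) (u j)"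
      "alg_p fl zs f z t n =
        (\<Sum>j\<le>n. (f j * u j) * (\<Prod>i\<in>{..n} - {j}. (z - t * zs i) / (zs j - zs i)))"
      using alg_p_backward_error[OF n] by auto
    have "norm (u j - 1) \<le> eps * K + C * eps\<^sup>2" if "j \<le> n" for j
    proof -
      have "real (n + 1) * (c Add * ?h + 2 * (c Sub * ?h) + c Mul * ?h + c Div * ?h)
          = real (n + 1) * (S * ?h)"
        by (simp add: S_def algebra_simps)
      also have "\<dots> \<le> real (N + 1) * (S * ?h)"
        using n S eps M by (intro mult_right_mono) auto
      also have "\<dots> = K * ?h"
        by (simp add: K)
      finally have "near_one (K * ?h) (u j)"
        using u(1)[OF that] near_one_mono by blast
      then have "norm (u j - 1) \<le> exp (K * ?h) - 1"
        by (simp add: near_one_def)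
      also have "\<dots> \<le> eps * K + (2 * M * K + 4 * K\<^sup>2) * eps\<^sup>2"
        using exp_minus_one_first_order[of K eps M] K(2) eps M small by simp
      also have "\<dots> \<le> eps * K + C * eps\<^sup>2"
        by (simp add: C_def mult_right_mono)
      finally show ?thesis .
    qed
    then show ?thesis
      using u(2) by (intro exI[of _ "\<lambda>j. u j - 1"]) simp
  qed
  show ?thesis
    using C0 eps0 main by blast
qed

theorem theorem2:
  fixes N :: nat
  assumes "N \<ge> 1"
  shows "(\<forall>(zs :: nat \<Rightarrow> real) (f :: nat \<Rightarrow> real) (z :: real) (t :: real).
        inj_on zs {..N} \<longrightarrow> (\<forall>j\<le>N. z \<noteq> t * zs j) \<longrightarrow>
        (\<exists>C>0. \<exists>eps0>0. \<forall>eps F fl.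
           fp_arithmetic real_op_const eps F fl \<longrightarrow> eps \<le> eps0 \<longrightarrow>
           (\<forall>j\<le>N. zs j \<in> F \<and> f j \<in> F) \<longrightarrow> z \<in> F \<longrightarrow> t \<in> F \<longrightarrow>
           (\<forall>j\<le>N. fl Mul t (zs j) = t * zs j) \<longrightarrow>
           (\<forall>n\<le>N. \<exists>\<delta> :: nat \<Rightarrow> real.
              alg_p fl zs f z t n =
                (\<Sum>j\<le>n. (f j * (1 + \<delta> j)) *
                   (\<Prod>i\<in>{..n} - {j}. (z - t * zs i) / (zs j - zs i))) \<and>
              (\<forall>j\<le>n. norm (\<delta> j) \<le> eps * (real (N + 1) * 5) + C * eps\<^sup>2)))) \<and>
     (\<forall>(zs :: nat \<Rightarrow> complex) (f :: nat \<Rightarrow> complex) (z :: complex) (t :: complex).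
        inj_on zs {..N} \<longrightarrow> (\<forall>j\<le>N. z \<noteq> t * zs j) \<longrightarrow>
        (\<exists>C>0. \<exists>eps0>0. \<forall>eps F fl.
           fp_arithmetic complex_op_const eps F fl \<longrightarrow> eps \<le> eps0 \<longrightarrow>
           (\<forall>j\<le>N. zs j \<in> F \<and> f j \<in> F) \<longrightarrow> z \<in> F \<longrightarrow> t \<in> F \<longrightarrow>
           (\<forall>j\<le>N. fl Mul t (zs j) = t * zs j) \<longrightarrow>
           (\<forall>n\<le>N. \<exists>\<delta> :: nat \<Rightarrow> complex.
              alg_p fl zs f z t n =
                (\<Sum>j\<le>n. (f j * (1 + \<delta> j)) *
                   (\<Prod>i\<in>{..n} - {j}. (z - t * zs i) / (zs j - zs i))) \<and>
              (\<forall>j\<le>n. norm (\<delta> j) \<le> eps * (real (N + 1) * (8 + 2 * sqrt 2)) + C * eps\<^sup>2))))"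
proof (intro conjI allI impI, goal_cases)
  case (1 zs f z t)
  show ?case
    by (rule alg_p_backward_error_first_order[where c = real_op_const])
      (use 1 in \<open>auto simp: real_op_const_def\<close>)
next
  case (2 zs f z t)
  have "0 \<le> complex_op_const opn" for opn
    by (cases opn) auto
  then show ?case
    by (rule alg_p_backward_error_first_order[where c = complex_op_const]) (use 2 in auto)
qed

end
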